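(* Every tensor $M\in\mathbb{E}\mathrm{la}_5$ admits the following uniquely defined decomposition (the Clebsch-Gordan Harmonic Decomposition associated to the family of projectors $(P^{(3,3)},P^{(3,1s)},P^{(3,1r)},P^{(2,2)},P^{(2,0)})$): there is a unique family consisting of $H^{2,3}\in\mathbb{K}^5$, $(H^{2,1s},H^{2,1r},H^{0,3})\in(\mathbb{K}^3)^3$ and $(v^{2,3},v^{2,1s},v^{2,1r},v^{0,1s},v^{0,1r})\in(\mathbb{K}^1)^5$ such that $$\begin{aligned} M={}&H^{2,3}+\tfrac43H^{2,1s}\cdot\Phi^{s\{1,3\}}+\tfrac32H^{2,1r}\cdot\Phi^{r\{1,3\}}+2\,\Phi^{\{2,0\}}\otimes H^{0,3}+\Phi^{\{5,1\}}\cdot v^{2,3}\\ &+\tfrac43(\Phi^{\{3,1\}}\cdot v^{2,1s})\cdot\Phi^{s\{1,3\}}+\tfrac32(\Phi^{\{3,1\}}\cdot v^{2,1r})\cdot\Phi^{r\{1,3\}}\\ &+\tfrac83(\Phi^{\{2,0\}}\otimes v^{0,1s})\cdot\Phi^{s\{1,3\}}+3(\Phi^{\{2,0\}}\otimes v^{0,1r})\cdot\Phi^{r\{1,3\}}. \end{aligned}$$ These elements are obtained from $M$ as follows: - $v^{0,1r}=\Phi^{\{0,2\}}:M\vdots\Phi^{r\{3,1\}}$ and $v^{0,1s}=\Phi^{\{0,2\}}:M\vdots\Phi^{s\{3,1\}}$; - $v^{2,1r}=m^{2,1r}:\mathrm{i}^{(2)}$ and $H^{2,1r}=m^{2,1r}-\Phi^{\{3,1\}}\cdot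 v^{2,1r}$; - $v^{2,1s}=m^{2,1s}:\mathrm{i}^{(2)}$ and $H^{2,1s}=m^{2,1s}-\Phi^{\{3,1\}}\cdot v^{2,1s}$; - $H^{0,3}=\Phi^{\{0,2\}}:M\vdots P^{(3,3)}$; - $v^{2,3}=\mathrm{tr}_{12}(\mathrm{tr}_{13}(M^{2,3}))$ and $H^{2,3}=M^{2,3}-\Phi^{\{5,1\}}\cdot v^{2,3}$, where $M^{2,3}:=P^{(2,2)}:M\vdots P^{(3,3)}$, $m^{2,1s}:=P^{(2,2)}:M\vdots\Phi^{s\{3,1\}}$ and $m^{2,1r}:=P^{(2,2)}:M\vdots\Phi^{r\{3,1\}}$.
   Context: Tensors are real tensors on $\mathbb{R}^2$ with its standard Euclidean structure, identified with their component arrays in an orthonormal basis (indices in $\{1,2\}$, summation over repeated indices, $\delta_{ij}$ the Kronecker delta). $\mathbb{K}^n$ for $n\ge1$ is the space of totally symmetric traceless tensors of order $n$ (dimension 2). Contractions: $X\cdot Y$, $X:Y$, $X\vdots Y$ contract, respectively, the last $1,2,3$ indices of $X$ with the first $1,2,3$ indices of $Y$, in the same order. $\mathrm{tr}_{ab}$ is the contraction of the $a$-th and $b$-th indices; thus $\mathrm{tr}_{12}(\mathrm{tr}_{13}X)$ has components $X_{ijijm}$ for a fifth-order tensor $X$. $\mathrm{i}^{(2)}$ has components $\delta_{ij}$. $\mathbb{T}_{(ij)k}$ is the space of third-order tensors with $T_{ijk}=T_{jik}$. $\mathbb{E}\mathrm{la}_5$ is the space of fifth-order tensors $M_{ijklm}$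 symmetric under $i\leftrightarrow j$ and under $k\leftrightarrow l$. $P^{(2,2)}_{ijkl}=\frac12(\delta_{ik}\delta_{jl}+\delta_{il}\delta_{jk}-\delta_{ij}\delta_{kl})$, $P^{(2,0)}_{ijkl}=\frac12\delta_{ij}\delta_{kl}$, $\Phi^{\{2,0\}}=\Phi^{\{0,2\}}=\frac12\mathrm{i}^{(2)}$. $\Phi^{s\{3,1\}}_{ijkl}=\frac14(\delta_{ij}\delta_{kl}+\delta_{ik}\delta_{jl}+\delta_{il}\delta_{jk})$ and $\Phi^{r\{3,1\}}_{ijkl}=\frac13(2\delta_{ij}\delta_{kl}-\delta_{ik}\delta_{jl}-\delta_{il}\delta_{jk})$; their transposes are $(\Phi^{s\{1,3\}})_{lijk}=\Phi^{s\{3,1\}}_{ijkl}$, $(\Phi^{r\{1,3\}})_{lijk}=\Phi^{r\{3,1\}}_{ijkl}$. $I_{ijklmn}=\frac12(\delta_{il}\delta_{jm}\delta_{kn}+\delta_{im}\delta_{jl}\delta_{kn})$ is the identity on $\mathbb{T}_{(ij)k}$; $P^{(3,1r)}=\frac32\Phi^{r\{3,1\}}\cdot\Phi^{r\{1,3\}}$, $P^{(3,1s)}=\frac43\Phi^{s\{3,1\}}\cdot\Phi^{s\{1,3\}}$, $P^{(3,3)}=I-P^{(3,1s)}-P^{(3,1r)}$. For $v\in\mathbb{R}^2=\mathbb{K}^1$: $(\Phi^{\{3,1\}}\cdot v)_{ijk}=\frac12(v_i\delta_{jk}+v_j\delta_{ik}-v_k\delta_{ij})$ and $$\begin{aligned}4(\Phi^{\{5,1\}}\cdot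 v)_{ijklm}={}&v_i(\delta_{jk}\delta_{lm}-\delta_{jl}\delta_{km}-\delta_{jm}\delta_{kl})-v_j\delta_{im}\delta_{kl}\\&+v_k(-2\delta_{ij}\delta_{lm}+\delta_{il}\delta_{jm}+2\delta_{im}\delta_{jl})+v_l\delta_{ik}\delta_{jm}+v_m\delta_{ij}\delta_{kl}.\end{aligned}$$ *)

theory Defs
  imports "HOL-Analysis.Analysis"
begin

text \<open>
  Tensors on the Euclidean plane are identified with their component arrays in an orthonormal
  basis; the component of \<open>X\<close> with indices \<open>i, j, k\<close> is \<open>X $ i $ j $ k\<close>, first index outermost.
\<close>

type_synonym tensor1 = "real^2"
type_synonym tensor2 = "tensor1^2"
type_synonym tensor3 = "tensor2^2"
type_synonym tensor4 = "tensor3^2"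
type_synonym tensor5 = "tensor4^2"
type_synonym tensor6 = "tensor5^2"

definition \<delta> :: "2 \<Rightarrow> 2 \<Rightarrow> real"
  where "\<delta> i j = (if i = j then 1 else 0)"

definition i2 :: tensor2
  where "i2 = (\<chi> i j. \<delta> i j)"


section \<open>Contractions, traces and tensor products\<close>

text \<open>
  \<open>dot\<close>, \<open>ddot\<close> and \<open>dddot\<close> contract the last 1, 2, 3 indices of the left factor with the first
  1, 2, 3 indices of the right factor, in the same order. The trailing digit is the number of
  free indices of the left factor. The right factor may have any number of further indices: they
  are carried by \<^typ>\<open>'a\<close>.
\<close>

definition dot2 :: "tensor3 \<Rightarrow> 'a::real_vector^2 \<Rightarrow> 'a^2^2"  (infixl "dot2" 70)
  where "X dot2 Y = (\<chi> i j. \<Sum>p\<in>UNIV. X $ i $ j $ p *\<^sub>R Y $ p)"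

definition dot3 :: "tensor4 \<Rightarrow> 'a::real_vector^2 \<Rightarrow> 'a^2^2^2"  (infixl "dot3" 70)
  where "X dot3 Y = (\<chi> i j k. \<Sum>p\<in>UNIV. X $ i $ j $ k $ p *\<^sub>R Y $ p)"

definition ddot0 :: "tensor2 \<Rightarrow> 'a::real_vector^2^2 \<Rightarrow> 'a"  (infixl "ddot0" 70)
  where "X ddot0 Y = (\<Sum>p\<in>UNIV. \<Sum>q\<in>UNIV. X $ p $ q *\<^sub>R Y $ p $ q)"

definition ddot1 :: "tensor3 \<Rightarrow> 'a::real_vector^2^2 \<Rightarrow> 'a^2"  (infixl "ddot1" 70)
  where "X ddot1 Y = (\<chi> i. \<Sum>p\<in>UNIV. \<Sum>q\<in>UNIV. X $ i $ p $ q *\<^sub>R Y $ p $ q)"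

definition ddot2 :: "tensor4 \<Rightarrow> 'a::real_vector^2^2 \<Rightarrow> 'a^2^2"  (infixl "ddot2" 70)
  where "X ddot2 Y = (\<chi> i j. \<Sum>p\<in>UNIV. \<Sum>q\<in>UNIV. X $ i $ j $ p $ q *\<^sub>R Y $ p $ q)"

definition dddot0 :: "tensor3 \<Rightarrow> 'a::real_vector^2^2^2 \<Rightarrow> 'a"  (infixl "dddot0" 70)
  where "X dddot0 Y =
    (\<Sum>p\<in>UNIV. \<Sum>q\<in>UNIV. \<Sum>r\<in>UNIV. X $ p $ q $ r *\<^sub>R Y $ p $ q $ r)"

definition dddot2 :: "tensor5 \<Rightarrow> 'a::real_vector^2^2^2 \<Rightarrow> 'a^2^2"  (infixl "dddot2" 70)
  where "X dddot2 Y =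
    (\<chi> i j. \<Sum>p\<in>UNIV. \<Sum>q\<in>UNIV. \<Sum>r\<in>UNIV. X $ i $ j $ p $ q $ r *\<^sub>R Y $ p $ q $ r)"

definition tens2 :: "tensor2 \<Rightarrow> 'a::real_vector \<Rightarrow> 'a^2^2"  (infixl "tens2" 70)
  where "X tens2 Y = (\<chi> i j. X $ i $ j *\<^sub>R Y)"

definition tr12 :: "'a::real_vector^2^2 \<Rightarrow> 'a"
  where "tr12 X = (\<Sum>p\<in>UNIV. X $ p $ p)"

definition tr13 :: "'a::real_vector^2^2^2 \<Rightarrow> 'a^2"
  where "tr13 X = (\<chi> j. \<Sum>p\<in>UNIV. X $ p $ j $ p)"


section \<open>Spaces of tensors\<close>

text \<open>
  Total symmetry and tracelessness for every order \<open>n\<close> at once: a tensor of order \<open>n\<close> is presented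
  as a function \<open>t\<close> of an index sequence that reads only the entries \<open>0, \<dots>, n - 1\<close>.
\<close>

definition sym_traceless :: "nat \<Rightarrow> ((nat \<Rightarrow> 2) \<Rightarrow> real) \<Rightarrow> bool"
  where "sym_traceless n t \<longleftrightarrow>
    (\<forall>\<sigma> x. \<sigma> permutes {..<n} \<longrightarrow> t (x \<circ> \<sigma>) = t x) \<and>
    (\<forall>a<n. \<forall>b<n. a \<noteq> b \<longrightarrow> (\<forall>x. (\<Sum>p\<in>UNIV. t (x(a := p, b := p))) = 0))"

definition K1 :: "tensor1 set"
  where "K1 = {v. sym_traceless 1 (\<lambda>x. v $ x 0)}"

definition K3 :: "tensor3 set"
  where "K3 = {H. sym_traceless 3 (\<lambda>x. H $ x 0 $ x 1 $ x 2)}"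

definition K5 :: "tensor5 set"
  where "K5 = {H. sym_traceless 5 (\<lambda>x. H $ x 0 $ x 1 $ x 2 $ x 3 $ x 4)}"

definition Ela5 :: "tensor5 set"
  where "Ela5 = {M. \<forall>i j k l m. M $ i $ j $ k $ l $ m = M $ j $ i $ k $ l $ m \<and>
                                M $ i $ j $ k $ l $ m = M $ i $ j $ l $ k $ m}"


section \<open>Projectors and embeddings\<close>

definition P22 :: tensor4
  where "P22 = (\<chi> i j k l. (\<delta> i k * \<delta> j l + \<delta> i l * \<delta> j k - \<delta> i j * \<delta> k l) / 2)"

definition Phi20 :: tensor2
  where "Phi20 = (1/2) *\<^sub>R i2"

definition Phi02 :: tensor2
  where "Phi02 = (1/2) *\<^sub>R i2"

definition Phi_s31 :: tensor4
  where "Phi_s31 = (\<chi> i j k l. (\<delta> i j * \<delta> k l + \<delta> i k * \<delta> j l + \<delta> i l * \<delta> j k) / 4)"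

definition Phi_r31 :: tensor4
  where "Phi_r31 = (\<chi> i j k l. (2 * \<delta> i j * \<delta> k l - \<delta> i k * \<delta> j l - \<delta> i l * \<delta> j k) / 3)"

definition Phi_s13 :: tensor4
  where "Phi_s13 = (\<chi> l i j k. Phi_s31 $ i $ j $ k $ l)"

definition Phi_r13 :: tensor4
  where "Phi_r13 = (\<chi> l i j k. Phi_r31 $ i $ j $ k $ l)"

text \<open>\<open>Id6\<close> is the identity on third-order tensors symmetric in their first two indices.\<close>

definition Id6 :: tensor6
  where "Id6 = (\<chi> i j k l m n. (\<delta> i l * \<delta> j m * \<delta> k n + \<delta> i m * \<delta> j l * \<delta> k n) / 2)"

definition P31r :: tensor6
  where "P31r = (3/2) *\<^sub>R (Phi_r31 dot3 Phi_r13)"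

definition P31s :: tensor6
  where "P31s = (4/3) *\<^sub>R (Phi_s31 dot3 Phi_s13)"

definition P33 :: tensor6
  where "P33 = Id6 - P31s - P31r"

text \<open>\<open>Phi31 v\<close> and \<open>Phi51 v\<close> are the contractions of the tensors \<open>\<Phi>\<^sup>{\<^sup>3\<^sup>,\<^sup>1\<^sup>}\<close> and \<open>\<Phi>\<^sup>{\<^sup>5\<^sup>,\<^sup>1\<^sup>}\<close> with \<open>v\<close>.\<close>

definition Phi31 :: "tensor1 \<Rightarrow> tensor3"
  where "Phi31 v = (\<chi> i j k. (v $ i * \<delta> j k + v $ j * \<delta> i k - v $ k * \<delta> i j) / 2)"

definition Phi51 :: "tensor1 \<Rightarrow> tensor5"
  where "Phi51 v = (\<chi> i j k l m.
    (v $ i * (\<delta> j k * \<delta> l m - \<delta> j l * \<delta> k m - \<delta> j m * \<delta> k l)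
     - v $ j * \<delta> i m * \<delta> k l
     + v $ k * (- 2 * \<delta> i j * \<delta> l m + \<delta> i l * \<delta> j m + 2 * \<delta> i m * \<delta> j l)
     + v $ l * \<delta> i k * \<delta> j m
     + v $ m * \<delta> i j * \<delta> k l) / 4)"


section \<open>The decomposition\<close>

type_synonym CG_family =
  "tensor5 \<times> tensor3 \<times> tensor3 \<times> tensor3 \<times> tensor1 \<times> tensor1 \<times> tensor1 \<times> tensor1 \<times> tensor1"

text \<open>
  The numerical factors come from the factorizations \<open>P31s = (4/3) \<Phi>\<^sup>s\<^sup>3\<^sup>1 \<cdot> \<Phi>\<^sup>s\<^sup>1\<^sup>3\<close>,
  \<open>P31r = (3/2) \<Phi>\<^sup>r\<^sup>3\<^sup>1 \<cdot> \<Phi>\<^sup>r\<^sup>1\<^sup>3\<close> and \<open>P20 = 2 \<Phi>\<^sup>2\<^sup>0 \<otimes> \<Phi>\<^sup>0\<^sup>2\<close>, where \<open>P20\<close> is the projector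
  with components \<open>\<delta> i j * \<delta> k l / 2\<close>.
\<close>

definition CG_decomposition :: "tensor5 \<Rightarrow> CG_family \<Rightarrow> bool"
  where "CG_decomposition M =
    (\<lambda>(H23, H21s, H21r, H03, v23, v21s, v21r, v01s, v01r).
      H23 \<in> K5 \<and> H21s \<in> K3 \<and> H21r \<in> K3 \<and> H03 \<in> K3 \<and>
      v23 \<in> K1 \<and> v21s \<in> K1 \<and> v21r \<in> K1 \<and> v01s \<in> K1 \<and> v01r \<in> K1 \<and>
      M = H23 + (4/3) *\<^sub>R (H21s dot2 Phi_s13) + (3/2) *\<^sub>R (H21r dot2 Phi_r13)
          + 2 *\<^sub>R (Phi20 tens2 H03) + Phi51 v23
          + (4/3) *\<^sub>R (Phi31 v21s dot2 Phi_s13) + (3/2) *\<^sub>R (Phi31 v21r dot2 Phi_r13)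
          + (8/3) *\<^sub>R ((Phi20 tens2 v01s) dot2 Phi_s13)
          + 3 *\<^sub>R ((Phi20 tens2 v01r) dot2 Phi_r13))"

end

theory Submission
  imports Defs
begin

text \<open>
  The projectors split the two index groups independently. On the first pair, \<open>M\<close> is the sum of a
  symmetric traceless part \<open>P22 : M\<close> and of \<open>2 \<Phi>\<^sup>2\<^sup>0 \<otimes> C\<close> with \<open>C = \<Phi>\<^sup>0\<^sup>2 : M\<close>. On the last triple, every
  third-order tensor symmetric in its first two indices is the sum of a harmonic tensor and of the
  images of two vectors under \<open>\<Phi>\<^sup>s\<^sup>1\<^sup>3\<close> and \<open>\<Phi>\<^sup>r\<^sup>1\<^sup>3\<close>, and contraction with \<open>P33\<close>, \<open>\<Phi>\<^sup>s\<^sup>3\<^sup>1\<close>, \<open>\<Phi>\<^sup>r\<^sup>3\<^sup>1\<close>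
  recovers the three pieces. This leaves tensors that are symmetric and traceless in the first pair
  and harmonic in the rest; such a tensor is a harmonic one plus \<open>\<Phi>\<^sup>5\<^sup>1 \<cdot> v\<close> (or \<open>\<Phi>\<^sup>3\<^sup>1 \<cdot> v\<close>), and \<open>v\<close> is
  found by a trace that annihilates harmonic tensors.
\<close>

subsection \<open>Harmonic tensors of order 1, 3 and 5\<close>

lemma \<delta>_eval [simp]: "\<delta> i i = 1" "\<delta> 1 2 = 0" "\<delta> 2 1 = 0"
  by (simp_all add: \<delta>_def)

definition count_twos :: "nat \<Rightarrow> (nat \<Rightarrow> 2) \<Rightarrow> nat"
  where "count_twos n x = (\<Sum>i<n. if x i = 2 then 1 else 0)"

text \<open>
  In dimension 2 a harmonic tensor is determined by its components as a function of the number of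
  indices equal to 2; tracelessness says that this function changes sign when its argument grows
  by 2.
\<close>

lemma sym_traceless_if_count_twos:
  assumes t: "\<And>x. t x = c (count_twos n x)"
    and c: "\<And>k. k + 2 \<le> n \<Longrightarrow> c (k + 2) = - c k"
  shows "sym_traceless n t"
  unfolding sym_traceless_def
proof (intro conjI allI impI)
  fix \<sigma> :: "nat \<Rightarrow> nat" and x :: "nat \<Rightarrow> 2"
  assume "\<sigma> permutes {..<n}"
  then have "count_twos n (x \<circ> \<sigma>) = count_twos n x"
    unfolding count_twos_def
    using sum.permute[of \<sigma> "{..<n}" "\<lambda>i. if x i = 2 then 1 else 0 :: nat"] by (simp add: o_def)
  then show "t (x \<circ> \<sigma>) = t x" by (simp add: t)
next
  fix a b :: nat and x :: "nat \<Rightarrow> 2"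
  assume ab: "a < n" "b < n" "a \<noteq> b"
  \<comment> \<open>\<open>s\<close> counts the twos away from positions \<open>a\<close> and
    \<open>b\<close>, so the two terms of the trace are \<open>c s\<close> and
    \<open>c (s + 2)\<close>. Two positions being free gives \<open>s + 2 \<le> n\<close>, which
    \<open>c\<close> requires.\<close>
  define s where "s = (\<Sum>i\<in>{..<n} - {a} - {b}. if x i = 2 then 1 else 0 :: nat)"
  have split: "count_twos n (x(a := p, b := p)) = s + (if p = 2 then 2 else 0)" for p
  proof -
    let ?g = "\<lambda>i. if (x(a := p, b := p)) i = 2 then 1 else 0 :: nat"
    have "sum ?g ({..<n} - {a} - {b}) = s"
      unfolding s_def by (rule sum.cong) auto
    then show ?thesis
      using ab sum.remove[of "{..<n}" a ?g] sum.remove[of "{..<n} - {a}" b ?g]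
      by (auto simp: count_twos_def)
  qed
  have "s \<le> card ({..<n} - {a} - {b})"
    unfolding s_def
    using sum_bounded_above[of "{..<n} - {a} - {b}" "\<lambda>i. if x i = 2 then 1 else 0 :: nat" 1]
    by simp
  also have "\<dots> = n - 2" using ab by simp
  finally have "s + 2 \<le> n" using ab by linarith
  from c[OF this] show "(\<Sum>p\<in>UNIV. t (x(a := p, b := p))) = 0"
    by (simp add: t split sum_2)
qed

text \<open>The general solution of the sign rule. Its two parameters are the two dimensions of a
  space of harmonic tensors.\<close>

fun alternating :: "real \<Rightarrow> real \<Rightarrow> nat \<Rightarrow> real"
  where
    "alternating a b 0 = a"
  | "alternating a b (Suc 0) = b"
  | "alternating a b (Suc (Suc k)) = - alternating a b k"

lemma sym_tracelessD_transpose: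
  assumes "sym_traceless n t" "a < n" "b < n"
  shows "t (x \<circ> Transposition.transpose a b) = t x"
  using assms permutes_swap_id[of a "{..<n}" b] unfolding sym_traceless_def by simp

lemma sym_tracelessD_trace:
  assumes "sym_traceless n t" "a < n" "b < n" "a \<noteq> b"
  shows "t (x(a := 1, b := 1)) + t (x(a := 2, b := 2)) = 0"
  using assms unfolding sym_traceless_def by (auto simp: sum_2)

lemma K1_eq_UNIV: "K1 = UNIV"
proof -
  have "sym_traceless 1 (\<lambda>x. v $ x 0)" for v :: tensor1
  proof (rule sym_traceless_if_count_twos)
    fix x :: "nat \<Rightarrow> 2"
    show "v $ x 0 = alternating (v $ 1) (v $ 2) (count_twos 1 x)"
      using exhaust_2[of "x 0"] by (auto simp: count_twos_def)
  qed simp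
  then show ?thesis by (simp add: K1_def)
qed

text \<open>Adjacent swaps generate all permutations, and symmetry carries one trace to all others.
  Conversely, these rules reduce every component to plus or minus \<open>H $ 1 $ 1 $ 1\<close> or
  \<open>H $ 2 $ 1 $ 1\<close>.\<close>

lemma K3_iff:
  "H \<in> K3 \<longleftrightarrow>
    (\<forall>k. H $ 1 $ 2 $ k = H $ 2 $ 1 $ k) \<and>
    (\<forall>i. H $ i $ 1 $ 2 = H $ i $ 2 $ 1) \<and>
    (\<forall>k. H $ 2 $ 2 $ k = - H $ 1 $ 1 $ k)"
    (is "_ \<longleftrightarrow> ?R")
proof
  assume "H \<in> K3"
  then have H: "sym_traceless 3 (\<lambda>x. H $ x 0 $ x 1 $ x 2)" by (simp add: K3_def)
  show ?R
  proof (intro conjI allI)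
    fix k :: 2
    show "H $ 1 $ 2 $ k = H $ 2 $ 1 $ k"
      \<comment> \<open>A list lookup serves as index sequence; only its first three entries are
        read.\<close>
      using sym_tracelessD_transpose[OF H, of 0 1 "(!) [2, 1, k]"]
      by (simp add: Transposition.transpose_def)
    show "H $ k $ 1 $ 2 = H $ k $ 2 $ 1"
      using sym_tracelessD_transpose[OF H, of 1 2 "(!) [k, 2, 1]"]
      by (simp add: Transposition.transpose_def)
    show "H $ 2 $ 2 $ k = - H $ 1 $ 1 $ k"
      using sym_tracelessD_trace[OF H, of 0 1 "(!) [1, 1, k]"] by simp
  qed
next
  assume H: ?R
  have "sym_traceless 3 (\<lambda>x. H $ x 0 $ x 1 $ x 2)"
  proof (rule sym_traceless_if_count_twos)
    fix x :: "nat \<Rightarrow> 2"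
    have "count_twos 3 x =
        (if x 0 = 2 then 1 else 0) + (if x 1 = 2 then 1 else 0) + (if x 2 = 2 then 1 else 0)"
      by (simp add: count_twos_def eval_nat_numeral)
    then show "H $ x 0 $ x 1 $ x 2 = alternating (H $ 1 $ 1 $ 1) (H $ 2 $ 1 $ 1) (count_twos 3 x)"
      using exhaust_2[of "x 0"] exhaust_2[of "x 1"] exhaust_2[of "x 2"]
      by (elim disjE) (simp_all add: H numeral_eq_Suc)
  qed simp
  then show "H \<in> K3" by (simp add: K3_def)
qed

lemma K5_iff:
  "H \<in> K5 \<longleftrightarrow>
    (\<forall>k l m. H $ 1 $ 2 $ k $ l $ m = H $ 2 $ 1 $ k $ l $ m) \<and>
    (\<forall>i l m. H $ i $ 1 $ 2 $ l $ m = H $ i $ 2 $ 1 $ l $ m) \<and>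
    (\<forall>i j m. H $ i $ j $ 1 $ 2 $ m = H $ i $ j $ 2 $ 1 $ m) \<and>
    (\<forall>i j k. H $ i $ j $ k $ 1 $ 2 = H $ i $ j $ k $ 2 $ 1) \<and>
    (\<forall>k l m. H $ 2 $ 2 $ k $ l $ m = - H $ 1 $ 1 $ k $ l $ m)"
    (is "_ \<longleftrightarrow> ?R")
proof
  assume "H \<in> K5"
  then have H: "sym_traceless 5 (\<lambda>x. H $ x 0 $ x 1 $ x 2 $ x 3 $ x 4)" by (simp add: K5_def)
  show ?R
  proof (intro conjI allI)
    fix i j k :: 2
    show "H $ 1 $ 2 $ i $ j $ k = H $ 2 $ 1 $ i $ j $ k"
      using sym_tracelessD_transpose[OF H, of 0 1 "(!) [2, 1, i, j, k]"]
      by (simp add: Transposition.transpose_def)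
    show "H $ i $ 1 $ 2 $ j $ k = H $ i $ 2 $ 1 $ j $ k"
      using sym_tracelessD_transpose[OF H, of 1 2 "(!) [i, 2, 1, j, k]"]
      by (simp add: Transposition.transpose_def)
    show "H $ i $ j $ 1 $ 2 $ k = H $ i $ j $ 2 $ 1 $ k"
      using sym_tracelessD_transpose[OF H, of 2 3 "(!) [i, j, 2, 1, k]"]
      by (simp add: Transposition.transpose_def)
    show "H $ i $ j $ k $ 1 $ 2 = H $ i $ j $ k $ 2 $ 1"
      using sym_tracelessD_transpose[OF H, of 3 4 "(!) [i, j, k, 2, 1]"]
      by (simp add: Transposition.transpose_def)
    show "H $ 2 $ 2 $ i $ j $ k = - H $ 1 $ 1 $ i $ j $ k"
      using sym_tracelessD_trace[OF H, of 0 1 "(!) [1, 1, i, j, k]"] by simp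
  qed
next
  assume H: ?R
  have "sym_traceless 5 (\<lambda>x. H $ x 0 $ x 1 $ x 2 $ x 3 $ x 4)"
  proof (rule sym_traceless_if_count_twos)
    fix x :: "nat \<Rightarrow> 2"
    have "count_twos 5 x = (if x 0 = 2 then 1 else 0) + (if x 1 = 2 then 1 else 0)
      + (if x 2 = 2 then 1 else 0) + (if x 3 = 2 then 1 else 0) + (if x 4 = 2 then 1 else 0)"
      by (simp add: count_twos_def eval_nat_numeral)
    then show "H $ x 0 $ x 1 $ x 2 $ x 3 $ x 4 =
      alternating (H $ 1 $ 1 $ 1 $ 1 $ 1) (H $ 2 $ 1 $ 1 $ 1 $ 1) (count_twos 5 x)"
      using exhaust_2[of "x 0"] exhaust_2[of "x 1"] exhaust_2[of "x 2"] exhaust_2[of "x 3"]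
        exhaust_2[of "x 4"]
      by (elim disjE) (simp_all add: H numeral_eq_Suc)
  qed simp
  then show "H \<in> K5" by (simp add: K5_def)
qed

subsection \<open>Linearity of the contractions\<close>

text \<open>With the first two indices fixed, \<open>dot2\<close> becomes \<open>dot0\<close> and
  \<open>dddot2\<close> becomes \<open>dddot0\<close>, so claims on fifth-order tensors reduce to
  third-order slices.\<close>

definition dot0 :: "tensor1 \<Rightarrow> 'a::real_vector^2 \<Rightarrow> 'a"  (infixl "dot0" 70)
  where "v dot0 Y = (\<Sum>p\<in>UNIV. v $ p *\<^sub>R Y $ p)"

lemma dot0_add: "(v + w) dot0 Y = v dot0 Y + w dot0 Y"
  by (simp add: dot0_def algebra_simps sum.distrib)

lemma dot0_scaleR: "(c *\<^sub>R v) dot0 Y = c *\<^sub>R (v dot0 Y)"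
  by (simp add: dot0_def scaleR_sum_right)

lemma dot0_zero: "0 dot0 Y = 0"
  by (simp add: dot0_def)

lemma dddot0_add: "(X + X') dddot0 Y = X dddot0 Y + X' dddot0 Y"
  by (simp add: dddot0_def algebra_simps sum.distrib)

lemma dddot0_zero: "0 dddot0 Y = 0"
  by (simp add: dddot0_def)

lemma dddot0_diff_right: "X dddot0 (Y - Z) = X dddot0 Y - X dddot0 Z"
  by (simp add: dddot0_def scaleR_diff_right sum_subtractf)

lemma dddot0_scaleR_right: "X dddot0 (c *\<^sub>R Y) = c *\<^sub>R (X dddot0 Y)"
  by (simp add: dddot0_def scaleR_sum_right mult.commute)

lemma dddot0_dot3: "X dddot0 (Y dot3 Z) = (X dddot0 Y) dot0 Z"
  by (simp add: dddot0_def dot3_def dot0_def sum_2 algebra_simps)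

lemma dot2_nth: "(X dot2 Y) $ i $ j = X $ i $ j dot0 Y"
  by (simp add: dot2_def dot0_def)

lemma dddot2_nth: "(X dddot2 Y) $ i $ j = X $ i $ j dddot0 Y"
  by (simp add: dddot2_def dddot0_def)

lemma tens2_nth: "(X tens2 Y) $ i $ j = X $ i $ j *\<^sub>R Y"
  by (simp add: tens2_def)

subsection \<open>Splitting off the first two indices\<close>

text \<open>Entries lie in an arbitrary vector space, so only the first two indices are constrained,
  whatever the order of the tensor.\<close>

definition sym_tf2 :: "'a::real_vector^2^2 \<Rightarrow> bool"
  where "sym_tf2 X \<longleftrightarrow> X $ 1 $ 2 = X $ 2 $ 1 \<and> X $ 1 $ 1 + X $ 2 $ 2 = 0"

lemma sym_tf2_P22: "sym_tf2 (P22 ddot2 X)"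
  by (simp add: sym_tf2_def P22_def ddot2_def sum_2)

lemma sym_tf2_add: "sym_tf2 X \<Longrightarrow> sym_tf2 Y \<Longrightarrow> sym_tf2 (X + Y)"
  by (simp add: sym_tf2_def algebra_simps)

lemma sym_tf2_scaleR: "sym_tf2 X \<Longrightarrow> sym_tf2 (c *\<^sub>R X)"
  by (simp add: sym_tf2_def flip: scaleR_add_right)

lemma sym_tf2_dot2: "sym_tf2 X \<Longrightarrow> sym_tf2 (X dot2 Y)"
  by (simp add: sym_tf2_def dot2_nth dot0_zero flip: dot0_add)

lemma sym_tf2_dddot2: "sym_tf2 X \<Longrightarrow> sym_tf2 (X dddot2 Y)"
  by (simp add: sym_tf2_def dddot2_nth dddot0_zero flip: dddot0_add)

lemma P22_Phi_decomposition:
  fixes X :: "'a::real_vector^2^2"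
  assumes "X $ 1 $ 2 = X $ 2 $ 1"
  shows "X = P22 ddot2 X + 2 *\<^sub>R (Phi20 tens2 (Phi02 ddot0 X))"
  using assms
  by (simp add: vec_eq_iff forall_2 P22_def ddot2_def ddot0_def tens2_def Phi20_def Phi02_def i2_def
      sum_2 scaleR_add_right flip: scaleR_add_left)

text \<open>\<open>P22\<close> fixes symmetric traceless pairs and kills multiples of
  \<open>i2\<close>. \<open>Phi02\<close> kills the former and is normalized to return
  \<open>C\<close> from the latter.\<close>

lemma P22_Phi_extraction:
  fixes D :: "'a::real_vector^2^2"
  assumes "sym_tf2 D"
  shows "P22 ddot2 (D + 2 *\<^sub>R (Phi20 tens2 C)) = D"
    and "Phi02 ddot0 (D + 2 *\<^sub>R (Phi20 tens2 C)) = C"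
proof -
  have D: "D $ 2 $ 1 = D $ 1 $ 2" "D $ 2 $ 2 = - D $ 1 $ 1"
    using assms by (auto simp: sym_tf2_def eq_neg_iff_add_eq_0 add.commute)
  have half: "- ((1/2) *\<^sub>R a) - (1/2) *\<^sub>R a = - a" for a :: 'a
    by (simp flip: scaleR_minus_left scaleR_left_diff_distrib)
  show "P22 ddot2 (D + 2 *\<^sub>R (Phi20 tens2 C)) = D" "Phi02 ddot0 (D + 2 *\<^sub>R (Phi20 tens2 C)) = C"
    by (simp_all add: D half vec_eq_iff forall_2 P22_def ddot2_def ddot0_def tens2_def Phi20_def Phi02_def
        i2_def sum_2 scaleR_add_right flip: scaleR_add_left)
qed

subsection \<open>Splitting off the last three indices\<close>

lemma dddot0_Id6:
  assumes "\<And>k. T $ 1 $ 2 $ k = T $ 2 $ 1 $ k"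
  shows "T dddot0 Id6 = T"
  by (simp add: assms dddot0_def Id6_def vec_eq_iff forall_2 sum_2)

lemma dddot0_P33:
  assumes "\<And>k. T $ 1 $ 2 $ k = T $ 2 $ 1 $ k"
  shows "T dddot0 P33 = T - (4/3) *\<^sub>R ((T dddot0 Phi_s31) dot0 Phi_s13)
    - (3/2) *\<^sub>R ((T dddot0 Phi_r31) dot0 Phi_r13)"
  by (simp add: P33_def P31s_def P31r_def dddot0_diff_right dddot0_scaleR_right dddot0_dot3
      dddot0_Id6[OF assms])

lemma dddot0_Phi_s31_nth:
  "(T dddot0 Phi_s31) $ 1 = (3 * T $ 1 $ 1 $ 1 + T $ 1 $ 2 $ 2 + T $ 2 $ 1 $ 2 + T $ 2 $ 2 $ 1) / 4"
  "(T dddot0 Phi_s31) $ 2 = (T $ 1 $ 1 $ 2 + T $ 1 $ 2 $ 1 + T $ 2 $ 1 $ 1 + 3 * T $ 2 $ 2 $ 2) / 4"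
  by (simp_all add: dddot0_def Phi_s31_def sum_2 add_divide_distrib)

lemma dddot0_Phi_r31_nth:
  "(T dddot0 Phi_r31) $ 1 = (2 * T $ 2 $ 2 $ 1 - T $ 1 $ 2 $ 2 - T $ 2 $ 1 $ 2) / 3"
  "(T dddot0 Phi_r31) $ 2 = (2 * T $ 1 $ 1 $ 2 - T $ 1 $ 2 $ 1 - T $ 2 $ 1 $ 1) / 3"
  by (simp_all add: dddot0_def Phi_r31_def sum_2 diff_divide_distrib)

lemma dot0_Phi_s13_nth:
  "(v dot0 Phi_s13) $ i $ j $ k = (\<delta> i j * v $ k + \<delta> i k * v $ j + \<delta> j k * v $ i) / 4"
  using exhaust_2[of i] exhaust_2[of j] exhaust_2[of k]
  by (auto simp: dot0_def Phi_s13_def Phi_s31_def sum_2)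

lemma dot0_Phi_r13_nth:
  "(v dot0 Phi_r13) $ i $ j $ k = (2 * \<delta> i j * v $ k - \<delta> i k * v $ j - \<delta> j k * v $ i) / 3"
  using exhaust_2[of i] exhaust_2[of j] exhaust_2[of k]
  by (auto simp: dot0_def Phi_r13_def Phi_r31_def sum_2)

text \<open>Symmetry in the first pair leaves six dimensions; removing the two vector parts leaves
  two, exactly those of \<open>K3\<close>.\<close>

lemma dddot0_P33_in_K3:
  assumes "\<And>k. T $ 1 $ 2 $ k = T $ 2 $ 1 $ k"
  shows "T dddot0 P33 \<in> K3"
  by (simp add: dddot0_P33[OF assms] K3_iff forall_2 assms dddot0_Phi_s31_nth dddot0_Phi_r31_nth
      dot0_Phi_s13_nth dot0_Phi_r13_nth field_simps)

text \<open>\<open>Phi_s31\<close> and \<open>Phi_r31\<close> annihilate \<open>K3\<close> and each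
  other's vector part; on their own part they act as 3/4 and 2/3, which the factors 4/3 and 3/2
  cancel.\<close>

lemma T3_extraction:
  fixes H :: tensor3 and s r :: tensor1
  assumes "H \<in> K3"
  defines "T \<equiv> H + (4/3) *\<^sub>R (s dot0 Phi_s13) + (3/2) *\<^sub>R (r dot0 Phi_r13)"
  shows "T dddot0 Phi_s31 = s" "T dddot0 Phi_r31 = r" "T dddot0 P33 = H"
proof -
  have H: "H $ 1 $ 2 $ k = H $ 2 $ 1 $ k" "H $ k $ 1 $ 2 = H $ k $ 2 $ 1"
    "H $ 2 $ 2 $ k = - H $ 1 $ 1 $ k" for k
    using assms by (simp_all add: K3_iff)
  show s: "T dddot0 Phi_s31 = s"
    by (simp add: T_def vec_eq_iff forall_2 dddot0_Phi_s31_nth dot0_Phi_s13_nth dot0_Phi_r13_nth H)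
  show r: "T dddot0 Phi_r31 = r"
    by (simp add: T_def vec_eq_iff forall_2 dddot0_Phi_r31_nth dot0_Phi_s13_nth dot0_Phi_r13_nth H)
  have "T $ 1 $ 2 $ k = T $ 2 $ 1 $ k" for k
    by (simp add: T_def dot0_Phi_s13_nth dot0_Phi_r13_nth H field_simps)
  from dddot0_P33[of T, OF this] show "T dddot0 P33 = H"
    unfolding s r by (simp add: T_def)
qed

subsection \<open>Separating harmonic and vector parts\<close>

lemma sym_tf2_K3: "H \<in> K3 \<Longrightarrow> sym_tf2 H"
  by (simp add: K3_iff sym_tf2_def vec_eq_iff)

lemma sym_tf2_K5: "H \<in> K5 \<Longrightarrow> sym_tf2 H"
  by (simp add: K5_iff sym_tf2_def vec_eq_iff)

lemma K5_nth: "H \<in> K5 \<Longrightarrow> H $ i $ j \<in> K3"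
  using exhaust_2[of i] exhaust_2[of j] by (auto simp: K3_iff K5_iff)

lemma sym_tf2_Phi31: "sym_tf2 (Phi31 v)"
  by (simp add: sym_tf2_def Phi31_def vec_eq_iff forall_2)

lemma sym_tf2_Phi51: "sym_tf2 (Phi51 v)"
  by (simp add: sym_tf2_def Phi51_def vec_eq_iff forall_2)

lemma Phi51_nth: "Phi51 v $ i $ j \<in> K3"
  using exhaust_2[of i] exhaust_2[of j]
  by (auto simp: K3_iff Phi51_def forall_2)

lemma Phi31_ddot1: "Phi31 v ddot1 i2 = v"
  by (simp add: Phi31_def ddot1_def i2_def vec_eq_iff forall_2 sum_2)

lemma K3_ddot1: "H \<in> K3 \<Longrightarrow> H ddot1 i2 = 0"
  by (simp add: K3_iff ddot1_def i2_def vec_eq_iff forall_2 sum_2)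

lemma tr_Phi51: "tr12 (tr13 (Phi51 v)) = v"
  by (simp add: Phi51_def tr12_def tr13_def vec_eq_iff forall_2 sum_2)

lemma tr_K5: "H \<in> K5 \<Longrightarrow> tr12 (tr13 H) = 0"
  by (simp add: K5_iff tr12_def tr13_def vec_eq_iff forall_2 sum_2)

lemma ddot1_add: "(X + Y) ddot1 i2 = X ddot1 i2 + Y ddot1 i2"
  by (simp add: ddot1_def vec_eq_iff sum_2 algebra_simps)

lemma tr12_add: "tr12 (X + Y) = tr12 X + tr12 Y"
  by (simp add: tr12_def sum.distrib)

lemma tr13_add: "tr13 (X + Y) = tr13 X + tr13 Y"
  by (simp add: tr13_def sum.distrib vec_eq_iff)

text \<open>Symmetric traceless pairs times vectors have dimension 2 * 2, which splits as
  \<open>K3\<close> plus one vector; \<open>Phi31\<close> embeds that vector.\<close>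

lemma diff_Phi31_in_K3:
  assumes "sym_tf2 m"
  shows "m - Phi31 (m ddot1 i2) \<in> K3"
proof -
  have "m $ 2 $ 1 $ k = m $ 1 $ 2 $ k" "m $ 2 $ 2 $ k = - m $ 1 $ 1 $ k" for k
    using assms by (auto simp: sym_tf2_def vec_eq_iff eq_neg_iff_add_eq_0 add.commute)
  then show ?thesis
    by (simp add: K3_iff Phi31_def ddot1_def i2_def forall_2 sum_2 field_simps)
qed

text \<open>The same count one level up: a symmetric traceless pair times \<open>K3\<close> has
  dimension 4, that of \<open>K5\<close> plus one vector.\<close>

lemma diff_Phi51_in_K5:
  assumes "sym_tf2 X" and "\<And>i j. X $ i $ j \<in> K3"
  shows "X - Phi51 (tr12 (tr13 X)) \<in> K5"
proof -
  have X: "X $ 2 $ 1 $ k $ l $ m = X $ 1 $ 2 $ k $ l $ m"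
    "X $ 2 $ 2 $ k $ l $ m = - X $ 1 $ 1 $ k $ l $ m" for k l m
    using assms(1) by (auto simp: sym_tf2_def vec_eq_iff eq_neg_iff_add_eq_0 add.commute)
  have "X $ i $ j $ 1 $ 2 $ m = X $ i $ j $ 2 $ 1 $ m"
    "X $ i $ j $ m $ 1 $ 2 = X $ i $ j $ m $ 2 $ 1"
    "X $ i $ j $ 2 $ 2 $ m = - X $ i $ j $ 1 $ 1 $ m" for i j m
    using assms(2)[of i j] by (simp_all add: K3_iff)
  with X show ?thesis
    by (simp add: K5_iff Phi51_def tr12_def tr13_def forall_2 sum_2 field_simps)
qed

subsection \<open>The decomposition\<close>

lemma tensor_eqI: "(\<And>i j. X $ i $ j = Y $ i $ j) \<Longrightarrow> X = Y"
  by (simp add: vec_eq_iff)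

text \<open>Regroups the nine terms by their behavior in the first pair, since 8/3 = 2 * 4/3 and 3 =
  2 * 3/2.\<close>

lemma CG_sum_eq:
  fixes H23 :: tensor5
  shows "H23 + (4/3) *\<^sub>R (H21s dot2 Phi_s13) + (3/2) *\<^sub>R (H21r dot2 Phi_r13)
      + 2 *\<^sub>R (Phi20 tens2 H03) + Phi51 v23
      + (4/3) *\<^sub>R (Phi31 v21s dot2 Phi_s13) + (3/2) *\<^sub>R (Phi31 v21r dot2 Phi_r13)
      + (8/3) *\<^sub>R ((Phi20 tens2 v01s) dot2 Phi_s13)
      + 3 *\<^sub>R ((Phi20 tens2 v01r) dot2 Phi_r13) =
    ((H23 + Phi51 v23) + (4/3) *\<^sub>R ((H21s + Phi31 v21s) dot2 Phi_s13)
      + (3/2) *\<^sub>R ((H21r + Phi31 v21r) dot2 Phi_r13))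
    + 2 *\<^sub>R (Phi20 tens2 (H03 + (4/3) *\<^sub>R (v01s dot0 Phi_s13) + (3/2) *\<^sub>R (v01r dot0 Phi_r13)))"
  by (rule tensor_eqI)
    (simp add: dot2_nth tens2_nth dot0_add dot0_scaleR scaleR_add_right)

text \<open>Inverts the regrouped sum in three stages: the first pair, then the last triple, then
  the traces. Uniqueness follows from the resulting formulas.\<close>

lemma CG_decompositionD:
  assumes "CG_decomposition M (H23, H21s, H21r, H03, v23, v21s, v21r, v01s, v01r)"
  defines "m21s \<equiv> P22 ddot2 M dddot2 Phi_s31"
    and "m21r \<equiv> P22 ddot2 M dddot2 Phi_r31"
    and "M23 \<equiv> P22 ddot2 M dddot2 P33"
  shows "v01r = Phi02 ddot0 M dddot0 Phi_r31" "v01s = Phi02 ddot0 M dddot0 Phi_s31"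
    "v21r = m21r ddot1 i2" "H21r = m21r - Phi31 v21r"
    "v21s = m21s ddot1 i2" "H21s = m21s - Phi31 v21s"
    "H03 = Phi02 ddot0 M dddot0 P33"
    "v23 = tr12 (tr13 M23)" "H23 = M23 - Phi51 v23"
proof -
  define D where "D = (H23 + Phi51 v23) + (4/3) *\<^sub>R ((H21s + Phi31 v21s) dot2 Phi_s13)
    + (3/2) *\<^sub>R ((H21r + Phi31 v21r) dot2 Phi_r13)"
  define C where "C = H03 + (4/3) *\<^sub>R (v01s dot0 Phi_s13) + (3/2) *\<^sub>R (v01r dot0 Phi_r13)"
  have K: "H23 \<in> K5" "H21s \<in> K3" "H21r \<in> K3" "H03 \<in> K3"
    and M: "M = D + 2 *\<^sub>R (Phi20 tens2 C)"
    using assms(1) by (simp_all add: CG_decomposition_def CG_sum_eq D_def C_def)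
  have "sym_tf2 D"
    unfolding D_def
    by (intro sym_tf2_add sym_tf2_scaleR sym_tf2_dot2 sym_tf2_K5 sym_tf2_K3 sym_tf2_Phi31
        sym_tf2_Phi51 K)
  then have D: "P22 ddot2 M = D" and C: "Phi02 ddot0 M = C"
    unfolding M by (rule P22_Phi_extraction)+
  \<comment> \<open>Each slice of \<open>D\<close> takes the form handled by
    \<open>T3_extraction\<close>, with its harmonic part in \<open>K3\<close>.\<close>
  have nth: "D $ i $ j = (H23 + Phi51 v23) $ i $ j + (4/3) *\<^sub>R ((H21s + Phi31 v21s) $ i $ j dot0 Phi_s13)
    + (3/2) *\<^sub>R ((H21r + Phi31 v21r) $ i $ j dot0 Phi_r13)" for i j
    by (simp add: D_def dot2_nth)
  have K3: "(H23 + Phi51 v23) $ i $ j \<in> K3" for i j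
    using K5_nth[OF K(1), of i j] Phi51_nth[of v23 i j] by (auto simp: K3_iff algebra_simps)
  have M23: "M23 = H23 + Phi51 v23"
    unfolding M23_def D
    by (rule tensor_eqI) (simp only: dddot2_nth nth T3_extraction(3)[OF K3])
  have m21s: "m21s = H21s + Phi31 v21s"
    unfolding m21s_def D
    by (rule tensor_eqI) (simp only: dddot2_nth nth T3_extraction(1)[OF K3])
  have m21r: "m21r = H21r + Phi31 v21r"
    unfolding m21r_def D
    by (rule tensor_eqI) (simp only: dddot2_nth nth T3_extraction(2)[OF K3])
  show "v01r = Phi02 ddot0 M dddot0 Phi_r31" "v01s = Phi02 ddot0 M dddot0 Phi_s31"
    "H03 = Phi02 ddot0 M dddot0 P33"
    unfolding C C_def by (simp_all only: T3_extraction[OF K(4)])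
  show "v21r = m21r ddot1 i2" "H21r = m21r - Phi31 v21r"
    "v21s = m21s ddot1 i2" "H21s = m21s - Phi31 v21s"
    "v23 = tr12 (tr13 M23)" "H23 = M23 - Phi51 v23"
    by (simp_all add: m21r m21s M23 ddot1_add K3_ddot1 K Phi31_ddot1 tr12_add tr13_add tr_K5 tr_Phi51)
qed

lemma CG_decomposition_exists:
  assumes "M \<in> Ela5"
  shows "\<exists>F. CG_decomposition M F"
proof -
  define D where "D = P22 ddot2 M"
  define C where "C = Phi02 ddot0 M"
  have "M $ 1 $ 2 = M $ 2 $ 1"
    using assms by (simp add: Ela5_def vec_eq_iff)
  then have M: "M = D + 2 *\<^sub>R (Phi20 tens2 C)"
    unfolding D_def C_def by (rule P22_Phi_decomposition)
  have symM: "M $ i $ j $ 1 $ 2 $ m = M $ i $ j $ 2 $ 1 $ m" for i j m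
    using assms unfolding Ela5_def by blast
  have symC: "C $ 1 $ 2 $ m = C $ 2 $ 1 $ m" for m
    by (simp add: C_def ddot0_def sum_2 symM)
  have symD: "D $ i $ j $ 1 $ 2 $ m = D $ i $ j $ 2 $ 1 $ m" for i j m
    by (simp add: D_def ddot2_def sum_2 symM)
  have tf: "sym_tf2 D" by (simp add: D_def sym_tf2_P22)
  have D: "D = D dddot2 P33 + (4/3) *\<^sub>R ((D dddot2 Phi_s31) dot2 Phi_s13)
    + (3/2) *\<^sub>R ((D dddot2 Phi_r31) dot2 Phi_r13)"
    by (rule tensor_eqI) (simp add: dddot2_nth dot2_nth dddot0_P33[OF symD])
  have C: "C = C dddot0 P33 + (4/3) *\<^sub>R ((C dddot0 Phi_s31) dot0 Phi_s13)
    + (3/2) *\<^sub>R ((C dddot0 Phi_r31) dot0 Phi_r13)"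
    by (simp add: dddot0_P33[OF symC])
  define vs where "vs = D dddot2 Phi_s31 ddot1 i2"
  define vr where "vr = D dddot2 Phi_r31 ddot1 i2"
  define v where "v = tr12 (tr13 (D dddot2 P33))"
  \<comment> \<open>The witnesses are the extraction formulas; each subtracted \<open>Phi51\<close>
    or \<open>Phi31\<close> term cancels in the regrouped sum, which then refolds to
    \<open>D\<close>, \<open>C\<close> and finally \<open>M\<close>.\<close>
  have "CG_decomposition M (D dddot2 P33 - Phi51 v, D dddot2 Phi_s31 - Phi31 vs,
    D dddot2 Phi_r31 - Phi31 vr, C dddot0 P33, v, vs, vr, C dddot0 Phi_s31, C dddot0 Phi_r31)"
    unfolding CG_decomposition_def prod.case CG_sum_eq
  proof (intro conjI)
    show "D dddot2 P33 - Phi51 v \<in> K5"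
      unfolding v_def
      by (rule diff_Phi51_in_K5)
        (simp_all only: sym_tf2_dddot2[OF tf] dddot2_nth dddot0_P33_in_K3[OF symD])
    show "D dddot2 Phi_s31 - Phi31 vs \<in> K3" "D dddot2 Phi_r31 - Phi31 vr \<in> K3"
      unfolding vs_def vr_def by (intro diff_Phi31_in_K3 sym_tf2_dddot2 tf)+
    show "C dddot0 P33 \<in> K3"
      by (rule dddot0_P33_in_K3) (rule symC)
  qed (simp_all add: K1_eq_UNIV flip: D C M)
  then show ?thesis ..
qed

theorem proposition5p12:
  fixes M :: tensor5
  assumes "M \<in> Ela5"
  shows "(\<exists>!F. CG_decomposition M F) \<and>
    (\<forall>H23 H21s H21r H03 v23 v21s v21r v01s v01r.
      CG_decomposition M (H23, H21s, H21r, H03, v23, v21s, v21r, v01s, v01r) \<longrightarrow>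
      (let M23 = P22 ddot2 M dddot2 P33;
           m21s = P22 ddot2 M dddot2 Phi_s31;
           m21r = P22 ddot2 M dddot2 Phi_r31
       in v01r = Phi02 ddot0 M dddot0 Phi_r31 \<and>
          v01s = Phi02 ddot0 M dddot0 Phi_s31 \<and>
          v21r = m21r ddot1 i2 \<and>
          H21r = m21r - Phi31 v21r \<and>
          v21s = m21s ddot1 i2 \<and>
          H21s = m21s - Phi31 v21s \<and>
          H03 = Phi02 ddot0 M dddot0 P33 \<and>
          v23 = tr12 (tr13 M23) \<and>
          H23 = M23 - Phi51 v23))"
proof (intro conjI ex_ex1I allI impI)
  show "\<exists>F. CG_decomposition M F"
    using assms by (rule CG_decomposition_exists)
next
  fix F G
  assume FG: "CG_decomposition M F" "CG_decomposition M G"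
  obtain H23 H21s H21r H03 v23 v21s v21r v01s v01r
    where F: "F = (H23, H21s, H21r, H03, v23, v21s, v21r, v01s, v01r)"
    by (metis surj_pair)
  obtain H23' H21s' H21r' H03' v23' v21s' v21r' v01s' v01r'
    where G: "G = (H23', H21s', H21r', H03', v23', v21s', v21r', v01s', v01r')"
    by (metis surj_pair)
  \<comment> \<open>Both families are given by the same expressions in \<open>M\<close>.\<close>
  note CG_decompositionD[OF FG(1)[unfolded F]] CG_decompositionD[OF FG(2)[unfolded G]]
  then show "F = G"
    unfolding F G by simp
next
  fix H23 H21s H21r H03 v23 v21s v21r v01s v01r
  assume "CG_decomposition M (H23, H21s, H21r, H03, v23, v21s, v21r, v01s, v01r)"
  note CG_decompositionD[OF this]
  then show "let M23 = P22 ddot2 M dddot2 P33;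
           m21s = P22 ddot2 M dddot2 Phi_s31;
           m21r = P22 ddot2 M dddot2 Phi_r31
       in v01r = Phi02 ddot0 M dddot0 Phi_r31 \<and>
          v01s = Phi02 ddot0 M dddot0 Phi_s31 \<and>
          v21r = m21r ddot1 i2 \<and>
          H21r = m21r - Phi31 v21r \<and>
          v21s = m21s ddot1 i2 \<and>
          H21s = m21s - Phi31 v21s \<and>
          H03 = Phi02 ddot0 M dddot0 P33 \<and>
          v23 = tr12 (tr13 M23) \<and>
          H23 = M23 - Phi51 v23"
    unfolding Let_def by (intro conjI)
qed

end
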